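(* Consider the multi-agent sampled-data system $\dot x_i(t)=f_i(x_i(t))+g_i(x_i(t))u_i(t_i^k)+\phi_i(t)$ for $t\in[t_i^k,t_i^{k+1})$, $i\in\mathcal V$, with asynchronous sampling times $\mathcal T_i=\{t_i^0,t_i^1,\dots\}$ satisfying $t_i^{k+1}-t_i^k=\Gamma_i+\delta_i(k)$, $|\delta_i(k)|\le\delta_i^{\max}$, for all $k\in\mathbb Z_{\ge0}$, where each adversarial agent $j\in\mathcal A$ applies $u_j(t_j^k)=u_j^{\max}(\vec x(t_j^k))$. For $i\in\mathcal N$ and $\vec x^{k_i}=\vec x(t_i^k)$ let $$K_i(\vec x^{k_i})=\Big\{u_i\in\mathcal U_i:\ L_{f_i}h^{x_i}(\vec x^{k_i})+L_{g_i}h^{x_i}(\vec x^{k_i})u_i+\sum_{l\in\mathcal N\setminus\{i\}}\big[L_{f_l}h^{x_l}(\vec x^{k_i})+L_{g_l}h^{x_l}(\vec x^{k_i})\hat u_l^{k_i}\big]+\sum_{j\in\mathcal A}\gamma_j^{\max}(\vec x^{k_i})+\alpha(h(\vec x^{k_i}))+\eta(\Gamma_i+\delta^{\max})\le0\Big\}.$$ If at sampling time $t_i^k$ for $k\ge0$, $i\in\mathcal N$ it holds that $\vec x^{k_i}\in S$, then for any $u_i^{k_i}\in K_i(\vec x^{k_i})$ the trajectory $\vec x(t)$ satisfies $\vec x(t)\in S$ for all $t\in[t_i^k,t_i^{k+1})$.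
   Context: Agents: $\mathcal V=\{1,\dots,N\}$, partitioned into adversarial agents $\mathcal A\subset\mathcal V$ (known) and normal agents $\mathcal N=\mathcal V\setminus\mathcal A$. Agent $i$ has state $x_i\in\mathbb R^{n_i}$ and input $u_i\in\mathbb R^{m_i}$; $\bar n=\sum_i n_i$ and $\vec x=[x_1^T,\dots,x_N^T]^T\in\mathbb R^{\bar n}$. A function of $x_i$ is also written as a function of $\vec x$. The maps $f_i:\mathbb R^{n_i}\to\mathbb R^{n_i}$, $g_i:\mathbb R^{n_i}\to\mathbb R^{n_i\times m_i}$ are locally Lipschitz; the disturbances $\phi_i:\mathbb R\to\mathbb R^{n_i}$ are locally Lipschitz with $\|\phi_i(t)\|\le\phi_i^{\max}$ for all $t\ge0$. Sampling and communication: each agent $i$ knows $\vec x(\cdot)$ only at its own sampling times (strictly increasing in $k$) and applies a zero-order-hold input, constant on $[t_i^k,t_i^{k+1})$, written $u_i^{k_i}=u_i(t_i^k)$. $\Gamma_i>0$ is the nominal period and $\delta^{\max}=\max_{i\in\mathcal V}\delta_i^{\max}$. Each normal agent updates its input at its sampling times and broadcasts it to all other agents; $\hat u_l^{k_i}$ is the most recent input value of normal agent $l$ received by agent $i$ at time $t_i^k$. Input constraints: $u_i\in\mathcal U_i(x_i)=\{u\in\mathbb R^{m_i}:A_i(x_i)u\le b_i(x_i)\}$, a nonempty compact convex polytope, with $A_i,b_i$ locally Lipschitz. For all $\vec x\in S$ the interior of $\mathcal U_i(\vec x)$, understood as $\{u:A_i(\vec x)u<b_i(\vec x)\}$, is nonempty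 and $\mathcal U_i$ is uniformly compact near $\vec x$ (there is a neighborhood of $\vec x$ such that the closure of the union of $\mathcal U_i(\vec y)$ over $\vec y$ in it is compact). Safe set: $h:\mathbb R^{\bar n}\to\mathbb R$ is continuously differentiable with locally Lipschitz gradient; $S=\{\vec x:h(\vec x)\le0\}$ is compact, $\partial S=\{h=0\}$, $\mathrm{int}(S)=\{h<0\}$. $\alpha:\mathbb R\to\mathbb R$ is a locally Lipschitz extended class-$\mathcal K_\infty$ function (continuous, strictly increasing, $\alpha(0)=0$, $\alpha(s)\to\pm\infty$ as $s\to\pm\infty$). Partial Lie derivatives: $L_{f_i}h^{x_i}(\vec x)=\frac{\partial h(\vec x)}{\partial x_i}f_i(x_i)$, and similarly for $g_i$ and $\phi_i(t)$. Adversaries: $u_j^{\max}(\vec x)\in\arg\max_{u\in\mathcal U_j(\vec x)}[L_{f_j}h^{x_j}(\vec x)+L_{g_j}h^{x_j}(\vec x)u]$, and $\gamma_j^{\max}(\vec x)=\max_{u\in\mathcal U_j(\vec x)}[L_{f_j}h^{x_j}(\vec x)+L_{g_j}h^{x_j}(\vec x)u]$. Constants: $c_f,c_g,c_\alpha,c_\gamma,c_h$ are constants such that for all $\vec x^1,\vec x^2\in S$: $\sum_{i\in\mathcal N}\|L_{f_i}h^{x_i}(\vec x^1)-L_{f_i}h^{x_i}(\vec x^2)\|\le c_f\|\vec x^1-\vec x^2\|$; $\sum_{i\in\mathcal N}\|L_{g_i}h^{x_i}(\vec x^1)-L_{g_i}h^{x_i}(\vec x^2)\|\le c_g\|\vec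 x^1-\vec x^2\|$; $\|\alpha(h(\vec x^1))-\alpha(h(\vec x^2))\|\le c_\alpha\|\vec x^1-\vec x^2\|$; $\sum_{j\in\mathcal A}\|\gamma_j^{\max}(\vec x^1)-\gamma_j^{\max}(\vec x^2)\|\le c_\gamma\|\vec x^1-\vec x^2\|$; $\|\sum_{l\in\mathcal V}L_{\phi_l}h^{x_l}(\vec x^1)\|\le c_h\sum_{l\in\mathcal V}\phi_l^{\max}$. The constant $u_{\max}\ge0$ satisfies $\|u_i^k\|\le u_{\max}$ for all $i\in\mathcal N$, $k\ge0$. The constant $\mu\ge0$ is an upper bound for the norm of the stacked vector with blocks $f_i(x_i)+g_i(x_i)u_i+\phi_i(t)$, $i=1,\dots,N$, over $\vec x\in S$, admissible inputs (all bounded by a common $u_M$) and $t\ge0$; $L'>0$ is any fixed constant. Define $\epsilon(\Gamma)=\frac{\mu}{L'}(e^{L'\Gamma}-1)$ and $$\eta(\Gamma)=(c_f+c_gu_{\max}+c_\alpha+c_\gamma)\,\epsilon(\Gamma)+c_h\sum_{l\in\mathcal V}\phi_l^{\max}.$$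
   Formalization: Added, since the claim fails otherwise: int(S) is nonempty; other normal agents l sampling inside the interval at a state in S also choose inputs from their K_l; each adversary's held input stays in U_j(x_j(t)) while it is applied. *)

theory Defs
  imports "HOL-Analysis.Analysis"
begin

text \<open>
  The agents are the elements of a finite type \<open>'v\<close>.  Since the dimensions may differ from agent to
  agent, a family of Euclidean spaces indexed by the agents is encoded by a finite type of
  coordinates together with an owner map: if \<open>own :: 's \<Rightarrow> 'v\<close>, then \<open>real ^ 's\<close> is the space of
  stacked vectors, and the space of agent \<open>i\<close>, whose dimension is the number of coordinates owned by
  \<open>i\<close>, is the subspace of the vectors that vanish outside these coordinates.  The embedding is
  isometric, and stacking the blocks of all the agents is their sum.
\<close>

definition blk :: "('s \<Rightarrow> 'v) \<Rightarrow> 'v \<Rightarrow> (real ^ 's::finite) set" where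
  "blk own i = {x. \<forall>s. own s \<noteq> i \<longrightarrow> x $ s = 0}"

definition proj :: "('s \<Rightarrow> 'v) \<Rightarrow> 'v \<Rightarrow> real ^ 's::finite \<Rightarrow> real ^ 's" where
  "proj own i x = (\<chi> s. if own s = i then x $ s else 0)"

definition blkmat ::
  "('r \<Rightarrow> 'v) \<Rightarrow> ('c \<Rightarrow> 'v) \<Rightarrow> 'v \<Rightarrow> (real ^ 'c::finite ^ 'r::finite) set" where
  "blkmat rown cown i = {M. \<forall>r c. rown r \<noteq> i \<or> cown c \<noteq> i \<longrightarrow> M $ r $ c = 0}"

definition locally_lipschitz_on ::
  "'a::metric_space set \<Rightarrow> ('a \<Rightarrow> 'b::metric_space) \<Rightarrow> bool" where
  "locally_lipschitz_on X F \<longleftrightarrow> local_lipschitz {0::real} X (\<lambda>_. F)"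

definition ext_class_Kinf :: "(real \<Rightarrow> real) \<Rightarrow> bool" where
  "ext_class_Kinf a \<longleftrightarrow> continuous_on UNIV a \<and> strict_mono a \<and> a 0 = 0 \<and>
     filterlim a at_top at_top \<and> filterlim a at_bot at_bot"

definition grad :: "(real ^ 's::finite \<Rightarrow> real) \<Rightarrow> real ^ 's \<Rightarrow> real ^ 's" where
  "grad h x = (\<chi> s. frechet_derivative h (at x) (axis s 1))"

text \<open>
  \<open>xown\<close>, \<open>uown\<close> and \<open>cown\<close> are the owner maps of the state coordinates, of the input coordinates
  and of the rows of the input constraints; \<open>advs\<close> is the set of adversarial agents.  The maps
  \<open>ff i\<close>, \<open>gg i\<close>, \<open>AA i\<close>, \<open>bb i\<close> are functions of the block of agent \<open>i\<close>; only their values on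
  \<open>blk xown i\<close> matter.
\<close>

record ('v, 's, 'm, 'q) mas =
  xown :: "'s::finite \<Rightarrow> 'v"
  uown :: "'m::finite \<Rightarrow> 'v"
  cown :: "'q::finite \<Rightarrow> 'v"
  advs :: "'v set"
  ff :: "'v \<Rightarrow> real ^ 's \<Rightarrow> real ^ 's"
  gg :: "'v \<Rightarrow> real ^ 's \<Rightarrow> real ^ 'm ^ 's"
  phi :: "'v \<Rightarrow> real \<Rightarrow> real ^ 's"
  phimax :: "'v \<Rightarrow> real"
  AA :: "'v \<Rightarrow> real ^ 's \<Rightarrow> real ^ 'm ^ 'q"
  bb :: "'v \<Rightarrow> real ^ 's \<Rightarrow> real ^ 'q"
  hh :: "real ^ 's \<Rightarrow> real"
  alpha :: "real \<Rightarrow> real"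

definition normals ::
  "('v::finite, 's::finite, 'm::finite, 'q::finite) mas \<Rightarrow> 'v set" where
  "normals P = UNIV - advs P"

definition safe ::
  "('v::finite, 's::finite, 'm::finite, 'q::finite) mas \<Rightarrow> (real ^ 's) set" where
  "safe P = {x. hh P x \<le> 0}"

definition xblk ::
  "('v::finite, 's::finite, 'm::finite, 'q::finite) mas \<Rightarrow> 'v \<Rightarrow> real ^ 's \<Rightarrow> real ^ 's" where
  "xblk P i = proj (xown P) i"

definition inputs ::
  "('v::finite, 's::finite, 'm::finite, 'q::finite) mas \<Rightarrow> 'v \<Rightarrow> real ^ 's \<Rightarrow> (real ^ 'm) set" where
  "inputs P i x = {v \<in> blk (uown P) i.
     \<forall>r. cown P r = i \<longrightarrow> (AA P i (xblk P i x) *v v) $ r \<le> bb P i (xblk P i x) $ r}"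

definition strict_inputs ::
  "('v::finite, 's::finite, 'm::finite, 'q::finite) mas \<Rightarrow> 'v \<Rightarrow> real ^ 's \<Rightarrow> (real ^ 'm) set" where
  "strict_inputs P i x = {v \<in> blk (uown P) i.
     \<forall>r. cown P r = i \<longrightarrow> (AA P i (xblk P i x) *v v) $ r < bb P i (xblk P i x) $ r}"

definition pgrad ::
  "('v::finite, 's::finite, 'm::finite, 'q::finite) mas \<Rightarrow> 'v \<Rightarrow> real ^ 's \<Rightarrow> real ^ 's" where
  "pgrad P i x = proj (xown P) i (grad (hh P) x)"

definition lie_f ::
  "('v::finite, 's::finite, 'm::finite, 'q::finite) mas \<Rightarrow> 'v \<Rightarrow> real ^ 's \<Rightarrow> real" where
  "lie_f P i x = pgrad P i x \<bullet> ff P i (xblk P i x)"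

definition lie_g ::
  "('v::finite, 's::finite, 'm::finite, 'q::finite) mas \<Rightarrow> 'v \<Rightarrow> real ^ 's \<Rightarrow> real ^ 'm" where
  "lie_g P i x = pgrad P i x v* gg P i (xblk P i x)"

definition lie_phi ::
  "('v::finite, 's::finite, 'm::finite, 'q::finite) mas \<Rightarrow> 'v \<Rightarrow> real \<Rightarrow> real ^ 's \<Rightarrow> real" where
  "lie_phi P i \<tau> x = pgrad P i x \<bullet> phi P i \<tau>"

text \<open>The supremum is a maximum, the set of inputs being nonempty and compact.\<close>

definition gamma_max ::
  "('v::finite, 's::finite, 'm::finite, 'q::finite) mas \<Rightarrow> 'v \<Rightarrow> real ^ 's \<Rightarrow> real" where
  "gamma_max P j x = (SUP v\<in>inputs P j x. lie_f P j x + lie_g P j x \<bullet> v)"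

definition regular_dynamics ::
  "('v::finite, 's::finite, 'm::finite, 'q::finite) mas \<Rightarrow> bool" where
  "regular_dynamics P \<longleftrightarrow> (\<forall>i.
     ff P i \<in> blk (xown P) i \<rightarrow> blk (xown P) i \<and>
     gg P i \<in> blk (xown P) i \<rightarrow> blkmat (xown P) (uown P) i \<and>
     locally_lipschitz_on (blk (xown P) i) (ff P i) \<and>
     locally_lipschitz_on (blk (xown P) i) (gg P i) \<and>
     range (phi P i) \<subseteq> blk (xown P) i \<and>
     locally_lipschitz_on UNIV (phi P i) \<and>
     (\<forall>\<tau>\<ge>0. norm (phi P i \<tau>) \<le> phimax P i))"

definition regular_inputs ::
  "('v::finite, 's::finite, 'm::finite, 'q::finite) mas \<Rightarrow> bool" where
  "regular_inputs P \<longleftrightarrow> (\<forall>i.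
     AA P i \<in> blk (xown P) i \<rightarrow> blkmat (cown P) (uown P) i \<and>
     bb P i \<in> blk (xown P) i \<rightarrow> blk (cown P) i \<and>
     locally_lipschitz_on (blk (xown P) i) (AA P i) \<and>
     locally_lipschitz_on (blk (xown P) i) (bb P i) \<and>
     (\<forall>x. inputs P i x \<noteq> {} \<and> compact (inputs P i x)) \<and>
     (\<forall>x\<in>safe P. strict_inputs P i x \<noteq> {} \<and>
        (\<exists>W. open W \<and> x \<in> W \<and> compact (closure (\<Union>y\<in>W. inputs P i y)))))"

text \<open>
  The safe set is required to have nonempty interior.  Otherwise, for instance with \<open>h x = x\<^sup>2\<close>, the
  constant \<open>0\<close> would be a Lipschitz constant on \<open>S\<close> of every function involved, and the margin
  \<open>eta\<close> below could vanish.
\<close>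

definition regular_safe_set ::
  "('v::finite, 's::finite, 'm::finite, 'q::finite) mas \<Rightarrow> bool" where
  "regular_safe_set P \<longleftrightarrow>
     (\<forall>x. hh P differentiable (at x)) \<and> locally_lipschitz_on UNIV (grad (hh P)) \<and>
     compact (safe P) \<and> frontier (safe P) = {x. hh P x = 0} \<and>
     interior (safe P) = {x. hh P x < 0} \<and> interior (safe P) \<noteq> {} \<and>
     ext_class_Kinf (alpha P) \<and> locally_lipschitz_on UNIV (alpha P)"

text \<open>The sequences of sampling times are unbounded, so that they cover all later times.\<close>

definition sampling ::
  "('v \<Rightarrow> real) \<Rightarrow> ('v \<Rightarrow> nat \<Rightarrow> real) \<Rightarrow> ('v \<Rightarrow> real) \<Rightarrow> ('v \<Rightarrow> nat \<Rightarrow> real) \<Rightarrow> bool" where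
  "sampling \<Gamma> \<delta> dmax t \<longleftrightarrow> (\<forall>i. 0 < \<Gamma> i \<and> 0 \<le> t i 0 \<and> strict_mono (t i) \<and>
     filterlim (t i) at_top sequentially \<and>
     (\<forall>k. t i (Suc k) - t i k = \<Gamma> i + \<delta> i k \<and> \<bar>\<delta> i k\<bar> \<le> dmax i))"

text \<open>
  The input applied by agent \<open>l\<close> at time \<open>\<tau> \<ge> t l 0\<close>, which for a normal agent is also the value most
  recently received from \<open>l\<close> by the other agents.  An input broadcast at time \<open>\<tau>\<close> itself counts as
  received.
\<close>

definition held :: "('v \<Rightarrow> nat \<Rightarrow> real) \<Rightarrow> ('v \<Rightarrow> nat \<Rightarrow> 'u) \<Rightarrow> 'v \<Rightarrow> real \<Rightarrow> 'u" where
  "held t u l \<tau> = u l (GREATEST k. t l k \<le> \<tau>)"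

definition trajectory ::
  "('v::finite, 's::finite, 'm::finite, 'q::finite) mas \<Rightarrow> ('v \<Rightarrow> nat \<Rightarrow> real) \<Rightarrow>
   ('v \<Rightarrow> nat \<Rightarrow> real ^ 'm) \<Rightarrow> (real \<Rightarrow> real ^ 's) \<Rightarrow> bool" where
  "trajectory P t u x \<longleftrightarrow> (\<forall>i.
     continuous_on {t i 0..} (\<lambda>\<tau>. xblk P i (x \<tau>)) \<and>
     (\<forall>k. \<forall>\<tau>\<in>{t i k..<t i (Suc k)}.
        ((\<lambda>\<sigma>. xblk P i (x \<sigma>)) has_vector_derivative
           ff P i (xblk P i (x \<tau>)) + gg P i (xblk P i (x \<tau>)) *v u i k + phi P i \<tau>)
        (at \<tau> within {t i k..<t i (Suc k)})))"

text \<open>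
  Every input is admissible when it is computed.  That of an adversary is admissible as long as it
  is held, so that its effect at time \<open>\<tau>\<close> is bounded by \<open>gamma_max P j (x \<tau>)\<close>.
\<close>

definition input_constraints ::
  "('v::finite, 's::finite, 'm::finite, 'q::finite) mas \<Rightarrow> ('v \<Rightarrow> nat \<Rightarrow> real) \<Rightarrow>
   ('v \<Rightarrow> nat \<Rightarrow> real ^ 'm) \<Rightarrow> (real \<Rightarrow> real ^ 's) \<Rightarrow> bool" where
  "input_constraints P t u x \<longleftrightarrow>
     (\<forall>i k. u i k \<in> inputs P i (x (t i k))) \<and>
     (\<forall>j\<in>advs P. \<forall>k. \<forall>\<tau>\<in>{t j k..<t j (Suc k)}. u j k \<in> inputs P j (x \<tau>))"

text \<open>
  Since inputs are held, the bound on the speed covers the inputs of norm at most \<open>uM\<close> that are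
  admissible at some state, not necessarily the current one.
\<close>

definition speed_bound ::
  "('v::finite, 's::finite, 'm::finite, 'q::finite) mas \<Rightarrow> real \<Rightarrow> real \<Rightarrow> bool" where
  "speed_bound P uM \<mu> \<longleftrightarrow>
     (\<forall>x\<in>safe P. \<forall>v. (\<forall>i. v i \<in> (\<Union>y. inputs P i y) \<and> norm (v i) \<le> uM) \<longrightarrow>
        (\<forall>\<tau>\<ge>0. norm (\<Sum>i\<in>UNIV. ff P i (xblk P i x) + gg P i (xblk P i x) *v v i + phi P i \<tau>) \<le> \<mu>))"

definition eps :: "real \<Rightarrow> real \<Rightarrow> real \<Rightarrow> real" where
  "eps \<mu> L r = \<mu> / L * (exp (L * r) - 1)"

definition eta ::
  "('v::finite, 's::finite, 'm::finite, 'q::finite) mas \<Rightarrow> real \<Rightarrow> real \<Rightarrow> real \<Rightarrow> real \<Rightarrow> real \<Rightarrow> real \<Rightarrow>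
   real \<Rightarrow> real \<Rightarrow> real \<Rightarrow> real" where
  "eta P c_f c_g u_max c_alpha c_gamma c_h \<mu> L r =
     (c_f + c_g * u_max + c_alpha + c_gamma) * eps \<mu> L r + c_h * (\<Sum>l\<in>UNIV. phimax P l)"

text \<open>\<open>uhat\<close> contains the received inputs and \<open>e\<close> is the margin, to be chosen as a value of \<open>eta\<close>.\<close>

definition KK ::
  "('v::finite, 's::finite, 'm::finite, 'q::finite) mas \<Rightarrow> 'v \<Rightarrow> real ^ 's \<Rightarrow> ('v \<Rightarrow> real ^ 'm) \<Rightarrow>
   real \<Rightarrow> (real ^ 'm) set" where
  "KK P i x uhat e = {v \<in> inputs P i x.
     lie_f P i x + lie_g P i x \<bullet> v
     + (\<Sum>l\<in>normals P - {i}. lie_f P l x + lie_g P l x \<bullet> uhat l)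
     + (\<Sum>j\<in>advs P. gamma_max P j x) + alpha P (hh P x) + e \<le> 0}"

end

theory Submission
  imports Defs
begin

text \<open>
  Suppose that the run is in the safe set \<open>S\<close> up to a time \<open>\<theta>\<close> of the sampling interval of agent
  \<open>i\<close>, and let \<open>s\<close> be the latest sampling time of a normal agent up to \<open>\<theta>\<close>
  (\<open>latest_normal_update\<close>).  The constraint that this agent enforced at \<open>s\<close> speaks of the normal
  inputs that are still applied at \<open>\<theta>\<close>.  Replacing the state at \<open>s\<close> by the state at \<open>\<theta>\<close> changes it by
  at most \<open>gain\<close> times the displacement, where \<open>gain\<close> is \<open>c_f + c_g * u_max + c_alpha + c_gamma\<close>, and
  the disturbances contribute at most the second summand of \<open>eta\<close> (\<open>rate_le\<close>).  The displacement is
  at most \<open>\<mu> * (\<theta> - s)\<close>, the run having stayed in \<open>S\<close>, where the speed is bounded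
  (\<open>displacement_le\<close>); and \<open>s\<close> is less than one sampling period before \<open>\<theta>\<close>.

  If \<open>\<mu> > 0\<close>, the displacement is therefore strictly less than the \<open>eps\<close> in \<open>eta\<close>
  (\<open>displacement_less_eps\<close>).  As \<open>gain\<close> is positive (\<open>gain_pos\<close>), the right derivative of \<open>h\<close> along
  the run is negative whenever the run is on the boundary of \<open>S\<close>.  Strictness matters: the
  Lipschitz bounds are available in \<open>S\<close> only, so that a comparison argument for the differential
  inequality on \<open>h\<close>, which would have to look at the run after a supposed exit, is not possible.  With
  a strict sign at the boundary, the run remains in \<open>S\<close> for a short time after \<open>\<theta>\<close> (\<open>safe_right\<close>),
  and since \<open>S\<close> is closed, continuous induction (\<open>continuation_induct\<close>) covers the whole interval.

  If \<open>\<mu> = 0\<close>, strictness fails, but then every safe state is an equilibrium under every held input,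
  and the run does not move at all (\<open>at_rest\<close>).
\<close>

section \<open>Continuous functions with one-sided derivatives\<close>

text \<open>
  Continuous induction: the infimum of the points where \<open>Q\<close> fails would, by closedness, be a point
  where \<open>Q\<close> holds, and \<open>Q\<close> would then extend to the right of it.
\<close>

lemma continuation_induct:
  fixes Q :: "real \<Rightarrow> bool"
  assumes init: "Q a" and cl: "closed {s\<in>{a..b}. Q s}"
    and step: "\<And>s. a \<le> s \<Longrightarrow> s < b \<Longrightarrow> (\<And>r. a \<le> r \<Longrightarrow> r \<le> s \<Longrightarrow> Q r) \<Longrightarrow> eventually Q (at_right s)"
    and c: "a \<le> c" "c \<le> b"
  shows "Q c"
proof (rule ccontr)
  assume nQ: "\<not> Q c"
  define B where "B = {s\<in>{a..b}. \<not> Q s}"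
  define m where "m = Inf B"
  have cB: "c \<in> B" using nQ c by (simp add: B_def)
  have bdd: "bdd_below B" by (rule bdd_belowI[of _ a]) (simp add: B_def)
  have am: "a \<le> m" unfolding m_def by (rule cInf_greatest) (use cB in \<open>auto simp: B_def\<close>)
  have mc: "m \<le> c" unfolding m_def by (rule cInf_lower[OF cB bdd])
  have below: "Q s" if "a \<le> s" "s < m" for s
  proof (rule ccontr)
    assume "\<not> Q s"
    then have "s \<in> B" using that mc c by (simp add: B_def)
    then have "m \<le> s" unfolding m_def by (rule cInf_lower[OF _ bdd])
    then show False using that by simp
  qed
  have Qm: "Q m"
  proof (cases "m = a")
    case False
    then have "a < m" using am by simp
    have "{a..<m} \<subseteq> {s\<in>{a..b}. Q s}" using below mc c by auto
    then have "closure {a..<m} \<subseteq> {s\<in>{a..b}. Q s}" by (rule closure_minimal[OF _ cl])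
    then have "m \<in> {s\<in>{a..b}. Q s}" using \<open>a < m\<close> by (auto simp: subset_iff)
    then show ?thesis by simp
  qed (simp add: init)
  have "m < c" using mc nQ Qm by (cases "m = c") auto
  have "eventually Q (at_right m)"
  proof (rule step[OF am])
    show "m < b" using \<open>m < c\<close> c by simp
    show "Q r" if "a \<le> r" "r \<le> m" for r
      using that below[of r] Qm by (cases "r = m") auto
  qed
  then obtain d where d: "d > m" "\<And>s. m < s \<Longrightarrow> s < d \<Longrightarrow> Q s"
    unfolding eventually_at_right_field by auto
  have "d \<le> m" unfolding m_def
  proof (rule cInf_greatest)
    show "B \<noteq> {}" using cB by auto
    fix s assume s: "s \<in> B"
    then have "m \<le> s" unfolding m_def by (rule cInf_lower[OF _ bdd])
    moreover have "\<not> Q s" using s by (simp add: B_def)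
    ultimately show "d \<le> s" using d(2)[of s] Qm by (cases "s = m") (auto simp: not_less[symmetric])
  qed
  then show False using d by simp
qed

text \<open>
  The mean value inequality for right derivatives only.  A solution driven by held inputs has no
  two-sided derivative at the sampling times, and this form makes it unnecessary to cut the interval
  at all of them.
\<close>

lemma right_derivative_bound:
  fixes f :: "real \<Rightarrow> 'a::real_normed_vector"
  assumes "a \<le> b" and cont: "continuous_on {a..b} f"
    and der: "\<And>s. a \<le> s \<Longrightarrow> s < b \<Longrightarrow> \<exists>D. (f has_vector_derivative D) (at_right s) \<and> norm D \<le> B"
  shows "norm (f b - f a) \<le> B * (b - a)"
proof -
  (* The slack e absorbs the error of the linear approximation at each point. *)
  have slack: "norm (f b - f a) \<le> (B + e) * (b - a)" if e: "0 < e" for e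
  proof (rule continuation_induct[where Q = "\<lambda>s. norm (f s - f a) \<le> (B + e) * (s - a)" and a = a and b = b])
    show "closed {s \<in> {a..b}. norm (f s - f a) \<le> (B + e) * (s - a)}"
      by (intro continuous_on_closed_Collect_le continuous_intros cont)
    fix s assume s: "a \<le> s" "s < b" and Q: "\<And>r. a \<le> r \<Longrightarrow> r \<le> s \<Longrightarrow> norm (f r - f a) \<le> (B + e) * (r - a)"
    obtain D where D: "(f has_vector_derivative D) (at_right s)" "norm D \<le> B" using der s by blast
    have "eventually (\<lambda>r. norm (f r - f s - (r - s) *\<^sub>R D) \<le> e * norm (r - s)) (at_right s)"
      using D(1) e unfolding has_vector_derivative_def has_derivative_within_alt2 by blast
    moreover have "eventually (\<lambda>r. s < r) (at_right s)" by (simp add: eventually_at_right_less)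
    ultimately show "eventually (\<lambda>r. norm (f r - f a) \<le> (B + e) * (r - a)) (at_right s)"
    proof eventually_elim
      case (elim r)
      have "norm (f r - f a) = norm ((f r - f s - (r - s) *\<^sub>R D) + (r - s) *\<^sub>R D + (f s - f a))" by simp
      also have "\<dots> \<le> norm (f r - f s - (r - s) *\<^sub>R D) + norm ((r - s) *\<^sub>R D) + norm (f s - f a)"
        by (meson add_right_mono norm_triangle_ineq order_trans)
      also have "\<dots> \<le> e * (r - s) + (r - s) * B + (B + e) * (s - a)"
        using elim D(2) Q[OF s(1) order_refl] by (intro add_mono) (simp_all add: mult_left_mono)
      finally show ?case by (simp add: algebra_simps)
    qed
  qed (use \<open>a \<le> b\<close> in auto)
  show ?thesis
  proof (cases "a = b")
    case False
    then have ab: "0 < b - a" using \<open>a \<le> b\<close> by simp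
    show ?thesis
    proof (rule field_le_epsilon)
      fix e :: real assume "0 < e"
      then show "norm (f b - f a) \<le> B * (b - a) + e"
        using slack[of "e / (b - a)"] ab by (simp add: distrib_right)
    qed
  qed simp
qed

section \<open>Blocks of stacked vectors\<close>

lemma proj_in_blk: "proj own i y \<in> blk own i"
  by (simp add: blk_def proj_def)

lemma sum_proj: "(\<Sum>i\<in>UNIV. proj own i y) = y" for own :: "'s::finite \<Rightarrow> 'v::finite"
  by (simp add: vec_eq_iff proj_def)

lemma norm_proj_le: "norm (proj own i y) \<le> norm y"
  by (rule norm_le_componentwise_cart) (simp add: proj_def)

lemma proj_diff: "proj own i y - proj own i z = proj own i (y - z)"
  by (simp add: vec_eq_iff proj_def)

lemma inner_blk: "F \<in> blk own i \<Longrightarrow> G \<bullet> F = proj own i G \<bullet> F"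
  by (auto simp: inner_vec_def proj_def blk_def intro!: sum.cong)

lemma blkmat_mult_in_blk: "M \<in> blkmat ro co i \<Longrightarrow> M *v w \<in> blk ro i"
  by (simp add: blk_def blkmat_def matrix_vector_mult_def)

lemma frechet_derivative_eq_grad:
  assumes "h differentiable (at y)"
  shows "frechet_derivative h (at y) w = grad h y \<bullet> w"
proof -
  interpret D: linear "frechet_derivative h (at y)" using assms by (rule linear_frechet_derivative)
  have "frechet_derivative h (at y) w = frechet_derivative h (at y) (\<Sum>s\<in>UNIV. w $ s *\<^sub>R axis s 1)"
    by (simp add: basis_expansion flip: scalar_mult_eq_scaleR)
  also have "\<dots> = grad h y \<bullet> w"
    by (simp add: D.sum D.scaleR inner_vec_def grad_def mult.commute)
  finally show ?thesis .
qed

section \<open>The velocity of the system\<close>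

definition velocity ::
  "('v::finite, 's::finite, 'm::finite, 'q::finite) mas \<Rightarrow> real ^ 's \<Rightarrow> ('v \<Rightarrow> real ^ 'm) \<Rightarrow> real \<Rightarrow>
   real ^ 's" where
  "velocity P y v \<tau> = (\<Sum>i\<in>UNIV. ff P i (xblk P i y) + gg P i (xblk P i y) *v v i + phi P i \<tau>)"

lemma grad_inner_velocity:
  assumes "regular_dynamics P"
  shows "grad (hh P) y \<bullet> velocity P y v \<tau> = (\<Sum>i\<in>UNIV. lie_f P i y + lie_g P i y \<bullet> v i + lie_phi P i \<tau> y)"
proof -
  have "grad (hh P) y \<bullet> (ff P i (xblk P i y) + gg P i (xblk P i y) *v v i + phi P i \<tau>)
      = lie_f P i y + lie_g P i y \<bullet> v i + lie_phi P i \<tau> y" for i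
  proof -
    have b: "xblk P i y \<in> blk (xown P) i" by (simp add: xblk_def proj_in_blk)
    have "ff P i (xblk P i y) \<in> blk (xown P) i" "phi P i \<tau> \<in> blk (xown P) i"
      "gg P i (xblk P i y) \<in> blkmat (xown P) (uown P) i"
      using assms b unfolding regular_dynamics_def by blast+
    then have "ff P i (xblk P i y) \<in> blk (xown P) i" "phi P i \<tau> \<in> blk (xown P) i"
      "gg P i (xblk P i y) *v v i \<in> blk (xown P) i"
      by (simp_all add: blkmat_mult_in_blk)
    then show ?thesis
      by (simp add: inner_add_right inner_blk[where i = i and own = "xown P" and G = "grad (hh P) y"]
          lie_f_def lie_g_def lie_phi_def pgrad_def dot_lmul_matrix)
  qed
  then show ?thesis by (simp add: velocity_def inner_sum_right)
qed

text \<open>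
  The disturbances cancel in a difference of velocities, so the Lipschitz constant is the same at
  all times.
\<close>

lemma velocity_locally_lipschitz:
  fixes P :: "('v::finite, 's::finite, 'm::finite, 'q::finite) mas"
  assumes "regular_dynamics P"
  obtains r K where "0 < r" "0 \<le> K"
    "\<And>z \<tau>. z \<in> cball y r \<Longrightarrow> norm (velocity P z v \<tau> - velocity P y v \<tau>) \<le> K * norm (z - y)"
proof -
  have block: "\<exists>r>0. \<exists>K\<ge>0. \<forall>z\<in>cball y r. norm (F (xblk P i z) - F (xblk P i y)) \<le> K * norm (z - y)"
    if F: "locally_lipschitz_on (blk (xown P) i) F" for i and F :: "real ^ 's \<Rightarrow> 'b::real_normed_vector"
  proof -
    have b: "xblk P i z \<in> blk (xown P) i" for z by (simp add: xblk_def proj_in_blk)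
    obtain r K where r: "0 < r" and K: "K-lipschitz_on (cball (xblk P i y) r \<inter> blk (xown P) i) F"
      using F b[of y] unfolding locally_lipschitz_on_def local_lipschitz_def
      by (metis Int_iff centre_in_cball less_imp_le singletonI)
    have le: "norm (xblk P i z - xblk P i y) \<le> norm (z - y)" for z
      by (simp add: xblk_def proj_diff norm_proj_le)
    have "norm (F (xblk P i z) - F (xblk P i y)) \<le> K * norm (z - y)" if "z \<in> cball y r" for z
    proof -
      have "xblk P i z \<in> cball (xblk P i y) r"
        using that le[of z] by (simp add: dist_norm norm_minus_commute)
      then have "norm (F (xblk P i z) - F (xblk P i y)) \<le> K * norm (xblk P i z - xblk P i y)"
        using lipschitz_onD[OF K, of "xblk P i z" "xblk P i y"] r b by (simp add: dist_norm)
      also have "\<dots> \<le> K * norm (z - y)"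
        using le lipschitz_on_nonneg[OF K] by (rule mult_left_mono)
      finally show ?thesis .
    qed
    then show ?thesis using r lipschitz_on_nonneg[OF K] by blast
  qed
  have "\<exists>r K. 0 < r \<and> 0 \<le> K \<and> (\<forall>z\<in>cball y r.
      norm ((ff P i (xblk P i z) + gg P i (xblk P i z) *v v i) -
            (ff P i (xblk P i y) + gg P i (xblk P i y) *v v i)) \<le> K * norm (z - y))" for i
  proof -
    have lip: "locally_lipschitz_on (blk (xown P) i) (ff P i)" "locally_lipschitz_on (blk (xown P) i) (gg P i)"
      using assms unfolding regular_dynamics_def by blast+
    obtain r1 K1 where 1: "0 < r1" "0 \<le> K1"
      "\<And>z. z\<in>cball y r1 \<Longrightarrow> norm (ff P i (xblk P i z) - ff P i (xblk P i y)) \<le> K1 * norm (z - y)"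
      using block[OF lip(1)] by blast
    obtain r2 K2 where 2: "0 < r2" "0 \<le> K2"
      "\<And>z. z\<in>cball y r2 \<Longrightarrow> norm (gg P i (xblk P i z) - gg P i (xblk P i y)) \<le> K2 * norm (z - y)"
      using block[OF lip(2)] by blast
    have "linear (\<lambda>A :: real ^ 'm ^ 's. A *v v i)"
      by (intro linearI) (simp_all add: matrix_vector_mult_add_rdistrib scaleR_matrix_vector_assoc)
    then obtain C where "\<And>A :: real ^ 'm ^ 's. norm (A *v v i) \<le> C * norm A"
      using linear_bounded by blast
    then have C: "norm (A *v v i) \<le> \<bar>C\<bar> * norm A" for A :: "real ^ 'm ^ 's"
      by (meson abs_ge_self mult_right_mono norm_ge_zero order_trans)
    have "norm ((ff P i (xblk P i z) + gg P i (xblk P i z) *v v i) -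
            (ff P i (xblk P i y) + gg P i (xblk P i y) *v v i)) \<le> (K1 + \<bar>C\<bar> * K2) * norm (z - y)"
      if "z \<in> cball y (min r1 r2)" for z
    proof -
      have "norm ((ff P i (xblk P i z) + gg P i (xblk P i z) *v v i) -
            (ff P i (xblk P i y) + gg P i (xblk P i y) *v v i))
          = norm ((ff P i (xblk P i z) - ff P i (xblk P i y)) + (gg P i (xblk P i z) - gg P i (xblk P i y)) *v v i)"
        by (simp add: matrix_vector_mult_diff_rdistrib algebra_simps)
      also have "\<dots> \<le> norm (ff P i (xblk P i z) - ff P i (xblk P i y))
          + norm ((gg P i (xblk P i z) - gg P i (xblk P i y)) *v v i)"
        by (rule norm_triangle_ineq)
      also have "\<dots> \<le> K1 * norm (z - y) + \<bar>C\<bar> * (K2 * norm (z - y))"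
        using that 1(3)[of z] 2(3)[of z]
        by (intro add_mono order_trans[OF C] mult_left_mono) auto
      finally show ?thesis by (simp add: algebra_simps)
    qed
    then show ?thesis using 1 2
      by (intro exI[of _ "min r1 r2"] exI[of _ "K1 + \<bar>C\<bar> * K2"]) auto
  qed
  then obtain r K where rK: "\<And>i. 0 < r i" "\<And>i. 0 \<le> K i" "\<And>i z. z\<in>cball y (r i) \<Longrightarrow>
      norm ((ff P i (xblk P i z) + gg P i (xblk P i z) *v v i) -
            (ff P i (xblk P i y) + gg P i (xblk P i y) *v v i)) \<le> K i * norm (z - y)"
    by metis
  have "norm (velocity P z v \<tau> - velocity P y v \<tau>) \<le> (\<Sum>i\<in>UNIV. K i) * norm (z - y)"
    if "z \<in> cball y (Min (range r))" for z \<tau>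
  proof -
    have z: "z \<in> cball y (r i)" for i
      using that Min_le[of "range r" "r i"] by auto
    have "velocity P z v \<tau> - velocity P y v \<tau>
       = (\<Sum>i\<in>UNIV. (ff P i (xblk P i z) + gg P i (xblk P i z) *v v i) -
            (ff P i (xblk P i y) + gg P i (xblk P i y) *v v i))"
      by (simp add: velocity_def flip: sum_subtractf)
    also have "norm \<dots> \<le> (\<Sum>i\<in>UNIV. K i * norm (z - y))"
      by (intro sum_norm_le rK(3) z)
    finally show ?thesis by (simp add: sum_distrib_right)
  qed
  moreover have "0 < Min (range r)" using rK(1) by auto
  ultimately show thesis using that rK(2) by (meson sum_nonneg)
qed

section \<open>Runs of the sampled-data system\<close>

locale sampled_run =
  fixes P :: "('v::finite, 's::finite, 'm::finite, 'q::finite) mas"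
    and \<Gamma> dmax :: "'v \<Rightarrow> real" and \<delta> t :: "'v \<Rightarrow> nat \<Rightarrow> real"
    and u :: "'v \<Rightarrow> nat \<Rightarrow> real ^ 'm" and x :: "real \<Rightarrow> real ^ 's" and u_M \<mu> t0 :: real
  assumes dynamics: "regular_dynamics P" and safe_set: "regular_safe_set P"
    and sampled: "sampling \<Gamma> \<delta> dmax t" and run: "trajectory P t u x"
    and constraints: "input_constraints P t u x"
    and input_bound: "\<And>i k. norm (u i k) \<le> u_M" and speed: "speed_bound P u_M \<mu>"
    and started: "\<And>l. t l 0 \<le> t0"
begin

abbreviation applied :: "real \<Rightarrow> 'v \<Rightarrow> real ^ 'm" where
  "applied \<tau> l \<equiv> held t u l \<tau>"

lemma sampling_mono: "strict_mono (t l)"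
  using sampled unfolding sampling_def by blast

lemma start_nonneg: "0 \<le> t0"
proof -
  have "0 \<le> t l 0" for l using sampled unfolding sampling_def by blast
  then show ?thesis using started order_trans by blast
qed

lemma sampling_interval:
  assumes "t0 \<le> \<tau>"
  obtains k where "t l k \<le> \<tau>" "\<tau> < t l (Suc k)"
proof -
  have "filterlim (t l) at_top sequentially" using sampled unfolding sampling_def by blast
  then have "eventually (\<lambda>k. \<tau> < t l k) sequentially" by (simp add: filterlim_at_top_dense)
  then have ex: "\<exists>k. \<tau> < t l k" by (auto simp: eventually_sequentially)
  have first: "\<tau> < t l (LEAST k. \<tau> < t l k)" using ex by (rule LeastI_ex)
  have "t l 0 \<le> \<tau>" using started[of l] assms by simp
  with first obtain k where k: "(LEAST k. \<tau> < t l k) = Suc k"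
    by (cases "LEAST k. \<tau> < t l k") auto
  then have "\<not> \<tau> < t l k" by (metis lessI not_less_Least)
  with first k that show thesis by (simp add: not_less)
qed

lemma applied_eq:
  assumes "t l k \<le> \<tau>" "\<tau> < t l (Suc k)"
  shows "applied \<tau> l = u l k"
proof -
  have "(GREATEST k. t l k \<le> \<tau>) = k"
  proof (rule Greatest_equality)
    fix k' assume "t l k' \<le> \<tau>"
    then have "t l k' < t l (Suc k)" using assms by simp
    then show "k' \<le> k" using sampling_mono by (simp add: strict_mono_less)
  qed (rule assms)
  then show ?thesis by (simp add: held_def)
qed

lemma applied_right_constant:
  assumes "t0 \<le> \<tau>"
  shows "eventually (\<lambda>\<sigma>. applied \<sigma> = applied \<tau>) (at_right \<tau>)"
proof -
  have "eventually (\<lambda>\<sigma>. applied \<sigma> l = applied \<tau> l) (at_right \<tau>)" for l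
  proof -
    obtain k where k: "t l k \<le> \<tau>" "\<tau> < t l (Suc k)" by (rule sampling_interval[OF assms])
    have "eventually (\<lambda>\<sigma>. \<sigma> \<in> {\<tau><..<t l (Suc k)}) (at_right \<tau>)"
      using k(2) by (rule eventually_at_right_real)
    then show ?thesis
      by eventually_elim (use k applied_eq[of l k] in auto)
  qed
  then have "eventually (\<lambda>\<sigma>. \<forall>l. applied \<sigma> l = applied \<tau> l) (at_right \<tau>)"
    by (rule eventually_all_finite)
  then show ?thesis by (simp add: fun_eq_iff)
qed

lemma adversary_admissible:
  assumes "t0 \<le> \<tau>" "j \<in> advs P"
  shows "applied \<tau> j \<in> inputs P j (x \<tau>)"
proof -
  obtain k where k: "t j k \<le> \<tau>" "\<tau> < t j (Suc k)" by (rule sampling_interval[OF assms(1)])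
  then have "u j k \<in> inputs P j (x \<tau>)"
    using constraints assms(2) by (simp add: input_constraints_def)
  then show ?thesis using applied_eq[OF k] by simp
qed

lemma speed_le:
  assumes "t0 \<le> \<tau>" "y \<in> safe P" "0 \<le> \<sigma>"
  shows "norm (velocity P y (applied \<tau>) \<sigma>) \<le> \<mu>"
proof -
  have ok: "applied \<tau> l \<in> (\<Union>y. inputs P l y) \<and> norm (applied \<tau> l) \<le> u_M" for l
  proof -
    obtain k where k: "t l k \<le> \<tau>" "\<tau> < t l (Suc k)" by (rule sampling_interval[OF assms(1)])
    have "u l k \<in> inputs P l (x (t l k))"
      using constraints by (simp add: input_constraints_def)
    then show ?thesis using applied_eq[OF k] input_bound by auto
  qed
  from speed[unfolded speed_bound_def, THEN bspec, OF assms(2), THEN spec, THEN mp, OF allI[OF ok]]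
  show ?thesis using assms(3) unfolding velocity_def by blast
qed

lemma continuous_run: "continuous_on {t0..} x"
proof -
  have "continuous_on {t0..} (\<lambda>\<tau>. \<Sum>l\<in>UNIV. xblk P l (x \<tau>))"
  proof (rule continuous_on_sum)
    fix l
    have "continuous_on {t l 0..} (\<lambda>\<tau>. xblk P l (x \<tau>))" using run unfolding trajectory_def by blast
    then show "continuous_on {t0..} (\<lambda>\<tau>. xblk P l (x \<tau>))"
      by (rule continuous_on_subset) (use started in auto)
  qed
  then show ?thesis by (simp add: xblk_def sum_proj)
qed

lemma run_right_derivative:
  assumes "t0 \<le> \<tau>"
  shows "(x has_vector_derivative velocity P (x \<tau>) (applied \<tau>) \<tau>) (at_right \<tau>)"
proof -
  have "((\<lambda>\<sigma>. xblk P l (x \<sigma>)) has_vector_derivative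
      ff P l (xblk P l (x \<tau>)) + gg P l (xblk P l (x \<tau>)) *v applied \<tau> l + phi P l \<tau>) (at_right \<tau>)" for l
  proof -
    obtain k where k: "t l k \<le> \<tau>" "\<tau> < t l (Suc k)" by (rule sampling_interval[OF assms])
    have "((\<lambda>\<sigma>. xblk P l (x \<sigma>)) has_vector_derivative
        ff P l (xblk P l (x \<tau>)) + gg P l (xblk P l (x \<tau>)) *v u l k + phi P l \<tau>)
        (at \<tau> within {t l k..<t l (Suc k)})"
      using run k unfolding trajectory_def by simp
    then have "((\<lambda>\<sigma>. xblk P l (x \<sigma>)) has_vector_derivative
        ff P l (xblk P l (x \<tau>)) + gg P l (xblk P l (x \<tau>)) *v u l k + phi P l \<tau>)
        (at \<tau> within {\<tau>..(\<tau> + t l (Suc k)) / 2})"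
      by (rule has_vector_derivative_within_subset) (use k in auto)
    then show ?thesis using k applied_eq[OF k] by (simp add: at_within_Icc_at_right)
  qed
  then have "((\<lambda>\<sigma>. \<Sum>l\<in>UNIV. xblk P l (x \<sigma>)) has_vector_derivative velocity P (x \<tau>) (applied \<tau>) \<tau>)
      (at_right \<tau>)"
    unfolding velocity_def by (intro has_vector_derivative_sum)
  then show ?thesis by (simp add: xblk_def sum_proj)
qed

lemma run_right_limit: "t0 \<le> \<tau> \<Longrightarrow> (x \<longlongrightarrow> x \<tau>) (at_right \<tau>)"
  using has_vector_derivative_continuous[OF run_right_derivative] unfolding continuous_within .

lemma displacement_le:
  assumes "t0 \<le> s" "s \<le> \<theta>" and "\<And>r. s \<le> r \<Longrightarrow> r < \<theta> \<Longrightarrow> x r \<in> safe P"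
  shows "norm (x \<theta> - x s) \<le> \<mu> * (\<theta> - s)"
proof (rule right_derivative_bound[where f = x and a = s and b = \<theta>])
  show "continuous_on {s..\<theta>} x"
    by (rule continuous_on_subset[OF continuous_run]) (use assms in auto)
  show "\<exists>D. (x has_vector_derivative D) (at_right r) \<and> norm D \<le> \<mu>" if "s \<le> r" "r < \<theta>" for r
  proof (intro exI conjI)
    have r: "t0 \<le> r" using assms(1) that by simp
    show "(x has_vector_derivative velocity P (x r) (applied r) r) (at_right r)"
      using r by (rule run_right_derivative)
    show "norm (velocity P (x r) (applied r) r) \<le> \<mu>"
      by (rule speed_le[OF r assms(3)[OF that]]) (use start_nonneg r in simp)
  qed
qed (rule assms)

text \<open>
  At an interior point of the safe set continuity suffices; at a boundary point the right derivative
  of \<open>h\<close> along the run decides.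
\<close>

lemma safe_right:
  assumes \<tau>: "t0 \<le> \<tau>" "x \<tau> \<in> safe P"
    and inward: "hh P (x \<tau>) = 0 \<Longrightarrow> grad (hh P) (x \<tau>) \<bullet> velocity P (x \<tau>) (applied \<tau>) \<tau> < 0"
  shows "eventually (\<lambda>\<sigma>. x \<sigma> \<in> safe P) (at_right \<tau>)"
proof (cases "hh P (x \<tau>) = 0")
  case False
  have "interior (safe P) = {y. hh P y < 0}" using safe_set unfolding regular_safe_set_def by blast
  moreover have "hh P (x \<tau>) \<le> 0" using \<tau>(2) by (simp add: safe_def)
  ultimately have "x \<tau> \<in> interior (safe P)" using False by simp
  then have "eventually (\<lambda>\<sigma>. x \<sigma> \<in> interior (safe P)) (at_right \<tau>)"
    by (rule topological_tendstoD[OF run_right_limit[OF \<tau>(1)] open_interior])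
  then show ?thesis by eventually_elim (use interior_subset in blast)
next
  case True
  define D where "D = grad (hh P) (x \<tau>) \<bullet> velocity P (x \<tau>) (applied \<tau>) \<tau>"
  have diff: "hh P differentiable (at (x \<tau>))"
    using safe_set unfolding regular_safe_set_def by blast
  then have "(hh P has_derivative frechet_derivative (hh P) (at (x \<tau>))) (at (x \<tau>) within x ` {\<tau><..})"
    by (simp add: frechet_derivative_works has_derivative_at_withinI)
  from vector_derivative_diff_chain_within[OF run_right_derivative[OF \<tau>(1)] this]
  have "((hh P \<circ> x) has_real_derivative D) (at_right \<tau>)"
    by (simp add: frechet_derivative_eq_grad[OF diff] D_def has_real_derivative_iff_has_vector_derivative)
  then obtain d where d: "0 < d" "\<And>e. 0 < e \<Longrightarrow> e < d \<Longrightarrow> hh P (x (\<tau> + e)) < hh P (x \<tau>)"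
    using has_real_derivative_neg_dec_right[of "hh P \<circ> x" D \<tau> "{\<tau><..}"] inward[OF True] D_def by auto
  have "eventually (\<lambda>\<sigma>. \<sigma> \<in> {\<tau><..<\<tau> + d}) (at_right \<tau>)"
    using d(1) by (intro eventually_at_right_real) simp
  then show ?thesis
    by eventually_elim (use d(2)[of "_ - \<tau>"] True in \<open>force simp: safe_def\<close>)
qed

text \<open>
  The latest sampling time \<open>s\<close> of a normal agent up to \<open>\<theta>\<close>: from \<open>s\<close> to \<open>\<theta>\<close> no normal input changes,
  so the constraint computed at \<open>s\<close> concerns exactly the normal inputs that are applied at \<open>\<theta>\<close>.
\<close>

lemma latest_normal_update:
  assumes i: "i \<in> normals P" "t i k = t0" and \<theta>: "t i k \<le> \<theta>" "\<theta> < t i (Suc k)"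
  obtains l k' where "l \<in> normals P" "t0 \<le> t l k'" "t l k' \<le> \<theta>" "\<theta> < t l (Suc k')"
    "l = i \<and> k' = k \<or> l \<noteq> i \<and> t0 < t l k'"
    "\<And>l'. l' \<in> normals P \<Longrightarrow> applied (t l k') l' = applied \<theta> l'"
proof -
  have "\<exists>k'. t l k' \<le> \<theta> \<and> \<theta> < t l (Suc k') \<and> (l = i \<longrightarrow> k' = k)" for l
  proof (cases "l = i")
    case False
    have "t0 \<le> \<theta>" using i(2) \<theta>(1) by simp
    then obtain k' where "t l k' \<le> \<theta>" "\<theta> < t l (Suc k')" by (rule sampling_interval)
    then show ?thesis using False by blast
  qed (use \<theta> in blast)
  then have "\<exists>K. \<forall>l. t l (K l) \<le> \<theta> \<and> \<theta> < t l (Suc (K l)) \<and> (l = i \<longrightarrow> K l = k)"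
    by (intro choice) blast
  then obtain K where K: "\<And>l. t l (K l) \<le> \<theta>" "\<And>l. \<theta> < t l (Suc (K l))" "K i = k"
    by blast
  define s where "s = (MAX l\<in>normals P. t l (K l))"
  have s_ge: "t l (K l) \<le> s" if "l \<in> normals P" for l
    unfolding s_def using that by (intro Max_ge) auto
  have "s \<in> (\<lambda>l. t l (K l)) ` normals P" unfolding s_def using i(1) by (intro Max_in) auto
  then obtain l0 where l0: "l0 \<in> normals P" "s = t l0 (K l0)" by auto
  (* Other agents are only known to enforce the constraint after t0, so a tie at t0 goes to i. *)
  define l where "l = (if s = t0 then i else l0)"
  have l: "l \<in> normals P" "t l (K l) = s" using i l0 K(3) by (auto simp: l_def)
  have "t0 \<le> s" using s_ge[OF i(1)] K(3) i(2) by simp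
  moreover have "l = i \<and> K l = k \<or> l \<noteq> i \<and> t0 < s"
    using \<open>t0 \<le> s\<close> K(3) l(2) by (cases "l = i") (auto simp: l_def split: if_splits)
  moreover have "applied s l' = applied \<theta> l'" if "l' \<in> normals P" for l'
  proof -
    have "s \<le> \<theta>" using K(1)[of l] l by simp
    then have "applied s l' = u l' (K l')"
      using s_ge[OF that] K(2)[of l'] by (intro applied_eq) auto
    then show ?thesis using applied_eq[OF K(1,2)] by simp
  qed
  ultimately show thesis using that[of l "K l"] l K(1,2)[of l] by simp
qed

text \<open>
  If the speed bound is zero, the velocity vanishes at every safe state, whatever inputs are held;
  by local Lipschitz continuity the run cannot leave such a state.  This is the usual uniqueness
  argument: on a short interval the largest distance from the rest state is at most half of itself.
\<close>

lemma at_rest: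
  assumes \<mu>: "\<mu> = 0" and x0: "x t0 \<in> safe P" and \<tau>: "t0 \<le> \<tau>"
  shows "x \<tau> = x t0"
proof (rule continuation_induct[where Q = "\<lambda>\<tau>. x \<tau> = x t0" and a = t0 and b = \<tau>])
  have "closed ({t0..\<tau>} \<inter> x -` {x t0})"
    by (intro continuous_closed_preimage continuous_on_subset[OF continuous_run]) auto
  moreover have "{t0..\<tau>} \<inter> x -` {x t0} = {s \<in> {t0..\<tau>}. x s = x t0}" by auto
  ultimately show "closed {s \<in> {t0..\<tau>}. x s = x t0}" by simp
next
  fix s assume s: "t0 \<le> s" "s < \<tau>" and const: "\<And>r. t0 \<le> r \<Longrightarrow> r \<le> s \<Longrightarrow> x r = x t0"
  define y where "y = x t0"
  have xs: "x s = y" unfolding y_def using s(1) by (intro const) simp_all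
  obtain r K where r: "0 < r" and K: "0 \<le> K"
    and lip: "\<And>z \<sigma>. z \<in> cball y r \<Longrightarrow>
      norm (velocity P z (applied s) \<sigma> - velocity P y (applied s) \<sigma>) \<le> K * norm (z - y)"
    by (rule velocity_locally_lipschitz[OF dynamics, of y "applied s"]) blast
  have "eventually (\<lambda>\<sigma>. x \<sigma> \<in> ball y r) (at_right s)"
    using topological_tendstoD[OF run_right_limit[OF s(1)], of "ball y r"] xs r by simp
  then have "eventually (\<lambda>\<sigma>. x \<sigma> \<in> ball y r \<and> applied \<sigma> = applied s) (at_right s)"
    using applied_right_constant[OF s(1)] by eventually_elim simp
  then obtain b where b: "s < b" "\<And>\<sigma>. s < \<sigma> \<Longrightarrow> \<sigma> < b \<Longrightarrow> x \<sigma> \<in> ball y r \<and> applied \<sigma> = applied s"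
    unfolding eventually_at_right_field by auto
  (* The second bound makes K * (m - s) at most 1 / 2 for every m up to c, also when K is 0. *)
  define c where "c = min ((s + b) / 2) (s + 1 / (2 * (K + 1)))"
  have c: "s < c" "c < b" "c \<le> s + 1 / (2 * (K + 1))" using b(1) K by (auto simp: c_def min_less_iff_disj)
  have vel: "norm (velocity P (x \<sigma>) (applied \<sigma>) \<sigma>) \<le> K * norm (x \<sigma> - y)" if "s \<le> \<sigma>" "\<sigma> < b" for \<sigma>
  proof -
    have "x \<sigma> \<in> ball y r \<and> applied \<sigma> = applied s"
      using b(2)[of \<sigma>] that xs r by (cases "\<sigma> = s") auto
    then have near: "x \<sigma> \<in> cball y r" and held: "applied \<sigma> = applied s" by auto
    have "velocity P y (applied s) \<sigma> = 0"
      using speed_le[OF s(1), of y \<sigma>] x0 \<mu> start_nonneg s that by (simp add: y_def)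
    then show ?thesis using lip[OF near, of \<sigma>] held by simp
  qed
  have cont: "continuous_on {s..c} x"
    by (rule continuous_on_subset[OF continuous_run]) (use s in auto)
  have "\<exists>m\<in>{s..c}. \<forall>\<sigma>\<in>{s..c}. norm (x \<sigma> - y) \<le> norm (x m - y)"
    by (rule continuous_attains_sup) (use c in \<open>auto intro!: continuous_intros cont\<close>)
  then obtain m where m: "s \<le> m" "m \<le> c" "\<And>\<sigma>. s \<le> \<sigma> \<Longrightarrow> \<sigma> \<le> c \<Longrightarrow> norm (x \<sigma> - y) \<le> norm (x m - y)"
    by auto
  have "norm (x m - x s) \<le> (K * norm (x m - y)) * (m - s)"
  proof (rule right_derivative_bound[where f = x and a = s and b = m])
    show "continuous_on {s..m} x" using cont by (rule continuous_on_subset) (use m in auto)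
    show "\<exists>D. (x has_vector_derivative D) (at_right \<sigma>) \<and> norm D \<le> K * norm (x m - y)"
      if "s \<le> \<sigma>" "\<sigma> < m" for \<sigma>
    proof (intro exI conjI)
      show "(x has_vector_derivative velocity P (x \<sigma>) (applied \<sigma>) \<sigma>) (at_right \<sigma>)"
        using s that by (intro run_right_derivative) simp
      have "norm (velocity P (x \<sigma>) (applied \<sigma>) \<sigma>) \<le> K * norm (x \<sigma> - y)"
        using that m c by (intro vel) auto
      also have "\<dots> \<le> K * norm (x m - y)" using m that K by (intro mult_left_mono) auto
      finally show "norm (velocity P (x \<sigma>) (applied \<sigma>) \<sigma>) \<le> K * norm (x m - y)" .
    qed
  qed (rule m)
  also have "\<dots> = norm (x m - y) * (K * (m - s))" by simp
  also have "\<dots> \<le> norm (x m - y) * (1 / 2)"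
  proof (rule mult_left_mono)
    have "K * (m - s) \<le> K * (1 / (2 * (K + 1)))" using m(2) c(3) K by (intro mult_left_mono) auto
    also have "\<dots> \<le> 1 / 2" using K by (simp add: field_simps)
    finally show "K * (m - s) \<le> 1 / 2" .
  qed simp
  finally have "norm (x m - y) = 0" using xs by simp
  then have "x \<sigma> = y" if "s < \<sigma>" "\<sigma> < c" for \<sigma> using m(3)[of \<sigma>] that by simp
  then show "eventually (\<lambda>\<sigma>. x \<sigma> = x t0) (at_right s)"
    unfolding eventually_at_right_field y_def using c(1) by blast
qed (use \<tau> in auto)

end

section \<open>Propagating the safety constraint\<close>

text \<open>Compactness of the input set makes the supremum one of a bounded set.\<close>

lemma gamma_max_upper:
  assumes "regular_inputs P" "v \<in> inputs P j y"
  shows "lie_f P j y + lie_g P j y \<bullet> v \<le> gamma_max P j y"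
  unfolding gamma_max_def
proof (rule cSUP_upper[OF assms(2)])
  have "compact (inputs P j y)" using assms(1) unfolding regular_inputs_def by blast
  then have "compact ((\<lambda>v. lie_f P j y + lie_g P j y \<bullet> v) ` inputs P j y)"
    by (intro compact_continuous_image continuous_intros)
  then show "bdd_above ((\<lambda>v. lie_f P j y + lie_g P j y \<bullet> v) ` inputs P j y)"
    by (intro bounded_imp_bdd_above compact_imp_bounded)
qed

locale lipschitz_constants =
  fixes P :: "('v::finite, 's::finite, 'm::finite, 'q::finite) mas"
    and c_f c_g c_alpha c_gamma c_h u_max :: real
  assumes lip_f: "\<And>y z. y \<in> safe P \<Longrightarrow> z \<in> safe P \<Longrightarrow>
        (\<Sum>i\<in>normals P. \<bar>lie_f P i y - lie_f P i z\<bar>) \<le> c_f * norm (y - z)"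
    and lip_g: "\<And>y z. y \<in> safe P \<Longrightarrow> z \<in> safe P \<Longrightarrow>
        (\<Sum>i\<in>normals P. norm (lie_g P i y - lie_g P i z)) \<le> c_g * norm (y - z)"
    and lip_alpha: "\<And>y z. y \<in> safe P \<Longrightarrow> z \<in> safe P \<Longrightarrow>
        \<bar>alpha P (hh P y) - alpha P (hh P z)\<bar> \<le> c_alpha * norm (y - z)"
    and lip_gamma: "\<And>y z. y \<in> safe P \<Longrightarrow> z \<in> safe P \<Longrightarrow>
        (\<Sum>j\<in>advs P. \<bar>gamma_max P j y - gamma_max P j z\<bar>) \<le> c_gamma * norm (y - z)"
    and bound_phi: "\<And>y \<tau>. y \<in> safe P \<Longrightarrow> 0 \<le> \<tau> \<Longrightarrow>
        \<bar>\<Sum>l\<in>UNIV. lie_phi P l \<tau> y\<bar> \<le> c_h * (\<Sum>l\<in>UNIV. phimax P l)"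
    and u_max_nonneg: "0 \<le> u_max"
begin

definition gain :: real where
  "gain = c_f + c_g * u_max + c_alpha + c_gamma"

text \<open>
  The safe set contains an interior and a boundary point, and \<open>alpha\<close> separates the values of \<open>h\<close> at
  the two: so \<open>c_alpha\<close> is positive, and the other constants are nonnegative.
\<close>

lemma gain_pos:
  assumes S: "regular_safe_set P"
  shows "0 < gain"
proof -
  have int: "interior (safe P) = {y. hh P y < 0}" "interior (safe P) \<noteq> {}"
    and fr: "frontier (safe P) = {y. hh P y = 0}" and cpt: "compact (safe P)"
    and \<alpha>: "strict_mono (alpha P)"
    using S unfolding regular_safe_set_def ext_class_Kinf_def by blast+
  have "safe P \<noteq> {}" using int(2) by auto
  moreover have "safe P \<noteq> UNIV" using compact_imp_bounded[OF cpt] not_bounded_UNIV by auto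
  ultimately have "frontier (safe P) \<noteq> {}" by (rule frontier_not_empty)
  then obtain z where z: "hh P z = 0" using fr by auto
  obtain y where y: "hh P y < 0" using int by auto
  have yz: "y \<in> safe P" "z \<in> safe P" using y z by (simp_all add: safe_def)
  have d: "0 < norm (y - z)" using y z by auto
  have nonneg: "0 \<le> c" if "r \<le> c * norm (y - z)" "0 \<le> r" for c r :: real
    using that d by (meson order_trans zero_le_mult_iff not_less)
  have "0 \<le> c_f" by (rule nonneg[OF lip_f[OF yz]]) (simp add: sum_nonneg)
  moreover have "0 \<le> c_g" by (rule nonneg[OF lip_g[OF yz]]) (simp add: sum_nonneg)
  moreover have "0 \<le> c_gamma" by (rule nonneg[OF lip_gamma[OF yz]]) (simp add: sum_nonneg)
  moreover have "0 < c_alpha"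
  proof -
    have "alpha P (hh P y) < alpha P (hh P z)" using \<alpha> y z by (simp add: strict_mono_less)
    then have "0 < c_alpha * norm (y - z)" using lip_alpha[OF yz] by linarith
    then show ?thesis using d by (simp add: zero_less_mult_iff)
  qed
  ultimately show ?thesis using u_max_nonneg by (simp add: gain_def add_nonneg_pos add_pos_nonneg)
qed

text \<open>
  The constraint checked at \<open>y\<close> controls the rate of \<open>h\<close> at a nearby state \<open>z\<close> under the same normal
  inputs: moving from \<open>y\<close> to \<open>z\<close> costs at most \<open>gain * norm (z - y)\<close>, which is deducted from the
  margin \<open>E\<close>.  The inputs of the adversaries need not be those foreseen at \<open>y\<close>, as \<open>gamma_max\<close> at \<open>z\<close>
  dominates them.
\<close>

lemma rate_le:
  assumes dyn: "regular_dynamics P" and inp: "regular_inputs P"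
    and yz: "y \<in> safe P" "z \<in> safe P" and \<tau>: "0 \<le> \<tau>"
    and normal: "\<And>l. l \<in> normals P \<Longrightarrow> norm (v l) \<le> u_max"
    and adv: "\<And>j. j \<in> advs P \<Longrightarrow> v j \<in> inputs P j z"
    and checked: "(\<Sum>l\<in>normals P. lie_f P l y + lie_g P l y \<bullet> v l) + (\<Sum>j\<in>advs P. gamma_max P j y)
      + alpha P (hh P y) + (gain * E + c_h * (\<Sum>l\<in>UNIV. phimax P l)) \<le> 0"
  shows "grad (hh P) z \<bullet> velocity P z v \<tau> \<le> - alpha P (hh P z) - gain * (E - norm (z - y))"
proof -
  define d where "d = norm (z - y)"
  have "(\<Sum>l\<in>normals P. (lie_f P l z + lie_g P l z \<bullet> v l) - (lie_f P l y + lie_g P l y \<bullet> v l))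
      \<le> (\<Sum>l\<in>normals P. \<bar>lie_f P l z - lie_f P l y\<bar> + norm (lie_g P l z - lie_g P l y) * u_max)"
  proof (rule sum_mono)
    fix l assume l: "l \<in> normals P"
    have "(lie_g P l z - lie_g P l y) \<bullet> v l \<le> norm (lie_g P l z - lie_g P l y) * norm (v l)"
      by (rule norm_cauchy_schwarz)
    also have "\<dots> \<le> norm (lie_g P l z - lie_g P l y) * u_max"
      using normal[OF l] by (intro mult_left_mono) auto
    finally show "(lie_f P l z + lie_g P l z \<bullet> v l) - (lie_f P l y + lie_g P l y \<bullet> v l)
        \<le> \<bar>lie_f P l z - lie_f P l y\<bar> + norm (lie_g P l z - lie_g P l y) * u_max"
      by (simp add: inner_diff_left)
  qed
  also have "\<dots> = (\<Sum>l\<in>normals P. \<bar>lie_f P l z - lie_f P l y\<bar>)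
      + (\<Sum>l\<in>normals P. norm (lie_g P l z - lie_g P l y)) * u_max"
    by (simp add: sum.distrib sum_distrib_right)
  also have "\<dots> \<le> c_f * d + (c_g * d) * u_max"
    using lip_f[OF yz(2,1)] lip_g[OF yz(2,1)] u_max_nonneg unfolding d_def
    by (intro add_mono mult_right_mono) auto
  finally have N: "(\<Sum>l\<in>normals P. lie_f P l z + lie_g P l z \<bullet> v l)
      \<le> (\<Sum>l\<in>normals P. lie_f P l y + lie_g P l y \<bullet> v l) + c_f * d + c_g * u_max * d"
    by (simp add: sum_subtractf algebra_simps)
  have "(\<Sum>j\<in>advs P. (lie_f P j z + lie_g P j z \<bullet> v j) - gamma_max P j y)
      \<le> (\<Sum>j\<in>advs P. \<bar>gamma_max P j z - gamma_max P j y\<bar>)"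
    by (rule sum_mono) (use gamma_max_upper[OF inp adv] in force)
  also have "\<dots> \<le> c_gamma * d" unfolding d_def by (rule lip_gamma[OF yz(2,1)])
  finally have A: "(\<Sum>j\<in>advs P. lie_f P j z + lie_g P j z \<bullet> v j)
      \<le> (\<Sum>j\<in>advs P. gamma_max P j y) + c_gamma * d"
    by (simp add: sum_subtractf)
  have \<alpha>: "alpha P (hh P z) \<le> alpha P (hh P y) + c_alpha * d"
    using lip_alpha[OF yz(2,1)] unfolding d_def by linarith
  have \<phi>: "(\<Sum>l\<in>UNIV. lie_phi P l \<tau> z) \<le> c_h * (\<Sum>l\<in>UNIV. phimax P l)"
    using bound_phi[OF yz(2) \<tau>] by linarith
  have "grad (hh P) z \<bullet> velocity P z v \<tau>
      = (\<Sum>l\<in>UNIV. lie_f P l z + lie_g P l z \<bullet> v l) + (\<Sum>l\<in>UNIV. lie_phi P l \<tau> z)"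
    by (simp add: grad_inner_velocity[OF dyn] sum.distrib)
  also have "(\<Sum>l\<in>UNIV. lie_f P l z + lie_g P l z \<bullet> v l)
      = (\<Sum>l\<in>normals P. lie_f P l z + lie_g P l z \<bullet> v l) + (\<Sum>j\<in>advs P. lie_f P j z + lie_g P j z \<bullet> v j)"
    unfolding normals_def by (rule sum.subset_diff) auto
  finally show ?thesis
    using N A \<alpha> \<phi> checked unfolding gain_def d_def[symmetric] by (simp add: algebra_simps)
qed

end

text \<open>
  \<open>KK\<close> treats the agent's own input separately; when that input is also the one recorded in \<open>v\<close>, the
  constraint is symmetric in the normal agents and no longer depends on who enforces it.
\<close>

lemma KK_constraint:
  assumes "i \<in> normals P" "w \<in> KK P i y v e" "w = v i"
  shows "(\<Sum>l\<in>normals P. lie_f P l y + lie_g P l y \<bullet> v l) + (\<Sum>j\<in>advs P. gamma_max P j y)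
    + alpha P (hh P y) + e \<le> 0"
proof -
  have "(\<Sum>l\<in>normals P. lie_f P l y + lie_g P l y \<bullet> v l) = (lie_f P i y + lie_g P i y \<bullet> v i)
      + (\<Sum>l\<in>normals P - {i}. lie_f P l y + lie_g P l y \<bullet> v l)"
    by (rule sum.remove[OF finite assms(1)])
  moreover have "v i \<in> KK P i y v e" using assms(2,3) by simp
  ultimately show ?thesis unfolding KK_def by (simp only: mem_Collect_eq)
qed

text \<open>
  The margin \<open>eps \<mu> L r\<close> is at least \<open>\<mu> * r\<close>, because \<open>exp\<close> lies above its tangent at \<open>0\<close>; that a
  sampling interval is half-open makes the duration \<open>d\<close> strictly shorter than \<open>r\<close>.
\<close>

lemma displacement_less_eps:
  assumes "0 < \<mu>" "0 < L" "d < r"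
  shows "\<mu> * d < eps \<mu> L r"
proof -
  have "\<mu> * d < \<mu> * r" using assms by simp
  also have "\<dots> = \<mu> / L * (L * r)" using assms by simp
  also have "\<dots> \<le> \<mu> / L * (exp (L * r) - 1)"
  proof (rule mult_left_mono)
    show "L * r \<le> exp (L * r) - 1" using exp_ge_add_one_self[of "L * r"] by linarith
  qed (use assms in simp)
  finally show ?thesis by (simp add: eps_def)
qed

section \<open>Invariance of the safe set\<close>

theorem theorem2:
  fixes P :: "('v::finite, 's::finite, 'm::finite, 'q::finite) mas"
    and \<Gamma> dmax :: "'v \<Rightarrow> real" and \<delta> t :: "'v \<Rightarrow> nat \<Rightarrow> real"
    and u :: "'v \<Rightarrow> nat \<Rightarrow> real ^ 'm" and x :: "real \<Rightarrow> real ^ 's"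
    and umaxadv :: "'v \<Rightarrow> real ^ 's \<Rightarrow> real ^ 'm"
    and c_f c_g c_alpha c_gamma c_h u_max u_M \<mu> L :: real
    and i :: 'v and k :: nat
  assumes "regular_dynamics P" and "regular_inputs P" and "regular_safe_set P"
    and "sampling \<Gamma> \<delta> dmax t" and "trajectory P t u x" and "input_constraints P t u x"
    and adversaries: "\<And>j y. j \<in> advs P \<Longrightarrow>
      is_arg_max (\<lambda>v. lie_f P j y + lie_g P j y \<bullet> v) (\<lambda>v. v \<in> inputs P j y) (umaxadv j y)"
      "\<And>j k. j \<in> advs P \<Longrightarrow> u j k = umaxadv j (x (t j k))"
    and constants: "\<And>y z. y \<in> safe P \<Longrightarrow> z \<in> safe P \<Longrightarrow>
        (\<Sum>i\<in>normals P. \<bar>lie_f P i y - lie_f P i z\<bar>) \<le> c_f * norm (y - z)"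
      "\<And>y z. y \<in> safe P \<Longrightarrow> z \<in> safe P \<Longrightarrow>
        (\<Sum>i\<in>normals P. norm (lie_g P i y - lie_g P i z)) \<le> c_g * norm (y - z)"
      "\<And>y z. y \<in> safe P \<Longrightarrow> z \<in> safe P \<Longrightarrow>
        \<bar>alpha P (hh P y) - alpha P (hh P z)\<bar> \<le> c_alpha * norm (y - z)"
      "\<And>y z. y \<in> safe P \<Longrightarrow> z \<in> safe P \<Longrightarrow>
        (\<Sum>j\<in>advs P. \<bar>gamma_max P j y - gamma_max P j z\<bar>) \<le> c_gamma * norm (y - z)"
      "\<And>y \<tau>. y \<in> safe P \<Longrightarrow> 0 \<le> \<tau> \<Longrightarrow>
        \<bar>\<Sum>l\<in>UNIV. lie_phi P l \<tau> y\<bar> \<le> c_h * (\<Sum>l\<in>UNIV. phimax P l)"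
    and "0 \<le> u_max" "\<And>i k. i \<in> normals P \<Longrightarrow> norm (u i k) \<le> u_max"
    and "\<And>i k. norm (u i k) \<le> u_M"
    and "0 \<le> \<mu>" "speed_bound P u_M \<mu>" and "0 < L"
    and "i \<in> normals P" and started: "\<And>l. t l 0 \<le> t i k" and "x (t i k) \<in> safe P"
    and "u i k \<in> KK P i (x (t i k)) (\<lambda>l. held t u l (t i k))
           (eta P c_f c_g u_max c_alpha c_gamma c_h \<mu> L (\<Gamma> i + Max (range dmax)))"
    and other_updates: "\<And>l k'. l \<in> normals P - {i} \<Longrightarrow> t l k' \<in> {t i k<..<t i (Suc k)} \<Longrightarrow>
      x (t l k') \<in> safe P \<Longrightarrow>
      u l k' \<in> KK P l (x (t l k')) (\<lambda>l'. held t u l' (t l k'))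
           (eta P c_f c_g u_max c_alpha c_gamma c_h \<mu> L (\<Gamma> l + Max (range dmax)))"
  shows "\<forall>\<tau>\<in>{t i k..<t i (Suc k)}. x \<tau> \<in> safe P"
  proof -
  define t0 where "t0 = t i k"
  have t0: "t i k = t0" and start: "t l 0 \<le> t0" for l using started by (simp_all add: t0_def)
  interpret sampled_run P \<Gamma> dmax \<delta> t u x u_M \<mu> t0
    by unfold_locales (fact assms start)+
  interpret lipschitz_constants P c_f c_g c_alpha c_gamma c_h u_max
    by unfold_locales (fact constants \<open>0 \<le> u_max\<close>)+
  have x0: "x t0 \<in> safe P" unfolding t0_def by fact
  show ?thesis
  proof (cases "\<mu> = 0")
    case True
    have "x \<tau> \<in> safe P" if "t i k \<le> \<tau>" for \<tau>
      unfolding at_rest[OF True x0 that[unfolded t0]] by (rule x0)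
    then show ?thesis by simp
  next
    case False
    then have \<mu>: "0 < \<mu>" using \<open>0 \<le> \<mu>\<close> by simp
    have "x \<tau> \<in> safe P" if \<tau>: "t i k \<le> \<tau>" "\<tau> < t i (Suc k)" for \<tau>
    proof (rule continuation_induct[where Q = "\<lambda>\<tau>. x \<tau> \<in> safe P" and a = t0 and b = \<tau>])
      have "closed ({t0..\<tau>} \<inter> x -` safe P)"
        using safe_set unfolding regular_safe_set_def
        by (intro continuous_closed_preimage continuous_on_subset[OF continuous_run])
          (auto intro: compact_imp_closed)
      moreover have "{t0..\<tau>} \<inter> x -` safe P = {s \<in> {t0..\<tau>}. x s \<in> safe P}" by auto
      ultimately show "closed {s \<in> {t0..\<tau>}. x s \<in> safe P}" by simp
    next
      fix \<theta> assume \<theta>: "t0 \<le> \<theta>" "\<theta> < \<tau>" and safe_before: "\<And>r. t0 \<le> r \<Longrightarrow> r \<le> \<theta> \<Longrightarrow> x r \<in> safe P"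
      have x\<theta>: "x \<theta> \<in> safe P" using \<theta>(1) by (intro safe_before) simp_all
      obtain l k' where l: "l \<in> normals P" and s: "t0 \<le> t l k'" "t l k' \<le> \<theta>" "\<theta> < t l (Suc k')"
        and which: "l = i \<and> k' = k \<or> l \<noteq> i \<and> t0 < t l k'"
        and same: "\<And>l'. l' \<in> normals P \<Longrightarrow> applied (t l k') l' = applied \<theta> l'"
        by (rule latest_normal_update[of i k \<theta>]) (use \<open>i \<in> normals P\<close> t0 \<theta> \<tau> in auto)
      define s where "s = t l k'"
      define E where "E = eps \<mu> L (\<Gamma> l + Max (range dmax))"
      have xs: "x s \<in> safe P" using s unfolding s_def by (intro safe_before)
      have E: "\<mu> * (\<theta> - s) < E" unfolding E_def
      proof (rule displacement_less_eps[OF \<mu> \<open>0 < L\<close>])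
        have "t l (Suc k') - t l k' = \<Gamma> l + \<delta> l k' \<and> \<bar>\<delta> l k'\<bar> \<le> dmax l"
          using sampled unfolding sampling_def by blast
        moreover have "dmax l \<le> Max (range dmax)" by (rule Max_ge) auto
        ultimately show "\<theta> - s < \<Gamma> l + Max (range dmax)" using s(3) unfolding s_def by linarith
      qed
      have near: "norm (x \<theta> - x s) < E"
        by (rule le_less_trans[OF displacement_le E]) (use s safe_before in \<open>auto simp: s_def\<close>)
      (* The agents other than i are bound to their constraint at s only because s is safe. *)
      have "u l k' \<in> KK P l (x s) (applied s)
          (eta P c_f c_g u_max c_alpha c_gamma c_h \<mu> L (\<Gamma> l + Max (range dmax)))"
      proof (cases "l = i")
        case True
        then have "k' = k" using which by simp
        show ?thesis unfolding s_def \<open>l = i\<close> \<open>k' = k\<close> by fact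
      next
        case False
        then show ?thesis unfolding s_def
          by (intro other_updates) (use l which s \<theta> \<tau> xs in \<open>auto simp: s_def t0_def\<close>)
      qed
      from KK_constraint[OF l this]
      have "(\<Sum>l\<in>normals P. lie_f P l (x s) + lie_g P l (x s) \<bullet> applied s l)
          + (\<Sum>j\<in>advs P. gamma_max P j (x s)) + alpha P (hh P (x s))
          + (gain * E + c_h * (\<Sum>l\<in>UNIV. phimax P l)) \<le> 0"
        using applied_eq[of l k' s] s by (simp add: s_def eta_def gain_def E_def)
      then have checked: "(\<Sum>l\<in>normals P. lie_f P l (x s) + lie_g P l (x s) \<bullet> applied \<theta> l)
          + (\<Sum>j\<in>advs P. gamma_max P j (x s)) + alpha P (hh P (x s))
          + (gain * E + c_h * (\<Sum>l\<in>UNIV. phimax P l)) \<le> 0"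
        using same by (simp add: s_def)
      have normal: "norm (applied \<theta> l') \<le> u_max" if "l' \<in> normals P" for l'
      proof -
        obtain k1 where k1: "t l' k1 \<le> \<theta>" "\<theta> < t l' (Suc k1)" by (rule sampling_interval[OF \<theta>(1)])
        have "norm (u l' k1) \<le> u_max" using that by (fact assms)
        then show ?thesis by (simp add: applied_eq[OF k1])
      qed
      have "grad (hh P) (x \<theta>) \<bullet> velocity P (x \<theta>) (applied \<theta>) \<theta>
          \<le> - alpha P (hh P (x \<theta>)) - gain * (E - norm (x \<theta> - x s))"
        by (rule rate_le[OF dynamics \<open>regular_inputs P\<close> xs x\<theta> _ normal _ checked])
          (use \<theta>(1) start_nonneg adversary_admissible[OF \<theta>(1)] in auto)
      moreover have "0 < gain * (E - norm (x \<theta> - x s))" using gain_pos[OF safe_set] near by simp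
      moreover have "alpha P 0 = 0"
        using safe_set unfolding regular_safe_set_def ext_class_Kinf_def by blast
      ultimately show "eventually (\<lambda>\<sigma>. x \<sigma> \<in> safe P) (at_right \<theta>)"
        by (intro safe_right[OF \<theta>(1) x\<theta>]) simp
    qed (use x0 \<tau> in \<open>auto simp: t0_def\<close>)
    then show ?thesis by simp
  qed
qed

end
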